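(* Let $\boldsymbol{\Sigma}=\{\{\sigma_{a|x}\}_{a\in\mathbb{A}}\}_{x\in\mathbb{X}}$ be a bipartite assemblage with Bob's Hilbert space $\mathcal{H}_B$ of finite dimension $d_B$, and let $\boldsymbol{\Sigma}'=\{\{\sigma'_{a'|x'}\}_{a'\in\mathbb{A}'}\}_{x'\in\mathbb{X}'}$ be a bipartite assemblage with Bob's Hilbert space $\mathcal{H}_{B'}$ of finite dimension $d_{B'}$. Let $\lambda$ range over the finite set of all pairs $\lambda=(f_\lambda,g_\lambda)$ of functions $f_\lambda:\mathbb{A}\times\mathbb{X}'\to\mathbb{A}'$ and $g_\lambda:\mathbb{X}'\to\mathbb{X}$ (there are $|\mathbb{A}'|^{|\mathbb{A}|\,|\mathbb{X}'|}\cdot|\mathbb{X}|^{|\mathbb{X}'|}$ of them), and put $D(a'|a,x',\lambda)=\delta_{a',f_\lambda(a,x')}$ and $D(x|x',\lambda)=\delta_{x,g_\lambda(x')}$. Then $\boldsymbol{\Sigma}$ can be converted into $\boldsymbol{\Sigma}'$ under LOSR operations if and only if the following semidefinite program is feasible: there exist operators $\{W_\lambda\}_\lambda$ on $\mathcal{H}_B\otimes\mathcal{H}_{B'}$ such that $$W_\lambda\ge 0\quad\text{and}\quad \mathrm{tr}_{B'}\{W_\lambda\}\propto \tfrac{1}{d_B}\mathbb{I}_B\quad\text{for all }\lambda,\qquad \sum_\lambda \mathrm{tr}_{B'}\{W_\lambda\}=\tfrac{1}{d_B}\mathbb{I}_B,$$ and, for all $a'\in\mathbb{A}'$, $x'\in\mathbb{X}'$,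 $$\sigma'_{a'|x'}=\sum_\lambda\sum_{a\in\mathbb{A},\,x\in\mathbb{X}} D(a'|a,x',\lambda)\,D(x|x',\lambda)\; d_B\,\mathrm{tr}_B\{W_\lambda(\mathbb{I}_{B'}\otimes\sigma_{a|x}^{T})\}.$$
   Context: All label sets $\mathbb{A},\mathbb{X},\mathbb{A}',\mathbb{X}'$ are finite. A bipartite assemblage is a collection $\boldsymbol{\Sigma}=\{\{\sigma_{a|x}\}_{a\in\mathbb{A}}\}_{x\in\mathbb{X}}$ of (unnormalised) positive semidefinite operators on $\mathcal{H}_B$ of the form $\sigma_{a|x}=\mathrm{tr}_A\{(M_{a|x}\otimes\mathbb{I})\rho\}$ for some Hilbert space $\mathcal{H}_A$, density operator $\rho$ on $\mathcal{H}_A\otimes\mathcal{H}_B$, and POVMs $\{M_{a|x}\}_{a\in\mathbb{A}}$ on $\mathcal{H}_A$, one for each $x\in\mathbb{X}$. One writes $\sigma_{a|x}=p(a|x)\rho_{a|x}$ with $p(a|x)=\mathrm{tr}\,\sigma_{a|x}$. LOSR (local operations and shared randomness) conversion: $\boldsymbol{\Sigma}$ can be converted into $\boldsymbol{\Sigma}'$ under LOSR operations if there exist finite-valued classical variables $\lambda$ and $c$, a probability distribution $p(\lambda)$, conditional probability distributions $p(c,x|x',\lambda)$ and $p(a'|a,c)$, and completely positive trace-preserving (CPTP) maps $\mathcal{E}_\lambda$ from operators on $\mathcal{H}_B$ to operators on $\mathcal{H}_{B'}$, such that for all $a',x'$ $$\sigma'_{a'|x'}=\sum_{\lambda,c}\sum_{a,x}p(\lambda)\,p(c,x|x',\lambda)\,p(a'|a,c)\,\mathcal{E}_\lambda(\sigma_{a|x}).$$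 Here $T$ denotes the transpose in a fixed orthonormal basis of $\mathcal{H}_B$, and in $W_\lambda(\mathbb{I}_{B'}\otimes\sigma^T_{a|x})$ the factor $\sigma^T_{a|x}$ acts on $\mathcal{H}_B$ and the identity acts on $\mathcal{H}_{B'}$. "$\propto$" means equal up to a scalar factor (which may depend on $\lambda$). *)

theory Defs
  imports "HOL-Analysis.Analysis"
begin

section \<open>Operators\<close>

text \<open>
  Operators on a finite-dimensional Hilbert space are complex square matrices with respect to a
  fixed orthonormal basis, which is indexed by a finite type. The basis of a tensor product is
  indexed by the product type.

  An operator on an arbitrary Hilbert space (Alice's space may be infinite-dimensional) is given by
  its matrix elements with respect to an orthonormal basis indexed by an arbitrary type.
  For a function \<open>K\<close> of two indices, \<open>psd_on S K\<close> says that every finite section of the matrix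
  \<open>K\<close> inside \<open>S \<times> S\<close> is positive semidefinite. For a bounded operator and \<open>S = UNIV\<close> this is
  positivity of the operator, since the finitely supported vectors are dense.
\<close>

definition psd_on :: "'i set \<Rightarrow> ('i \<Rightarrow> 'i \<Rightarrow> complex) \<Rightarrow> bool" where
  "psd_on S K \<longleftrightarrow> (\<forall>F v. finite F \<and> F \<subseteq> S \<longrightarrow>
     (\<Sum>i\<in>F. \<Sum>j\<in>F. cnj (v i) * K i j * v j) \<in> \<real>\<^sub>\<ge>\<^sub>0)"

definition psd :: "complex^'n^'n \<Rightarrow> bool" where
  "psd A \<longleftrightarrow> psd_on UNIV (\<lambda>i j. A $ i $ j)"

definition mat_scale :: "complex \<Rightarrow> complex^'m^'n \<Rightarrow> complex^'m^'n" where
  "mat_scale c A = map_matrix ((*) c) A"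

definition tensor :: "complex^'m^'m \<Rightarrow> complex^'n^'n \<Rightarrow> complex^('m::finite \<times> 'n::finite)^('m \<times> 'n)" where
  "tensor A B = (\<chi> p q. A $ fst p $ fst q * B $ snd p $ snd q)"

text \<open>Partial traces over the first and over the second tensor factor.\<close>

definition ptrace1 :: "complex^('m::finite \<times> 'n::finite)^('m \<times> 'n) \<Rightarrow> complex^'n^'n" where
  "ptrace1 W = (\<chi> k l. \<Sum>i\<in>UNIV. W $ (i, k) $ (i, l))"

definition ptrace2 :: "complex^('m::finite \<times> 'n::finite)^('m \<times> 'n) \<Rightarrow> complex^'m^'m" where
  "ptrace2 W = (\<chi> i j. \<Sum>k\<in>UNIV. W $ (i, k) $ (j, k))"


section \<open>Bipartite assemblages\<close>

text \<open>
  A matrix all of whose finite sections are positive semidefinite and whose diagonal sums to 1 is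
  the matrix of a unique positive trace-class operator of trace 1, so no boundedness condition is
  needed. Likewise, positive matrices that add up to the identity matrix are matrices of operators
  between 0 and the identity.
\<close>

definition density_op :: "('i \<Rightarrow> 'i \<Rightarrow> complex) \<Rightarrow> bool" where
  "density_op \<rho> \<longleftrightarrow> psd_on UNIV \<rho> \<and> ((\<lambda>i. \<rho> i i) has_sum 1) UNIV"

definition povm :: "('a::finite \<Rightarrow> 'h \<Rightarrow> 'h \<Rightarrow> complex) \<Rightarrow> bool" where
  "povm M \<longleftrightarrow> (\<forall>a. psd_on UNIV (M a)) \<and>
     (\<forall>i j. (\<Sum>a\<in>UNIV. M a i j) = (if i = j then 1 else 0))"

text \<open>
  The operator \<open>tr\<^sub>A {(M \<otimes> I) \<rho>}\<close>. The inner sum is an entry of the operator product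
  \<open>(M \<otimes> I) \<rho>\<close>, and the outer one is the trace over Alice's basis. For bounded \<open>M\<close> and
  trace-class \<open>\<rho>\<close> each of the two sums converges absolutely, but the joint sum over both indices
  need not, hence the iterated form.
\<close>

definition steer :: "('h \<Rightarrow> 'h \<Rightarrow> complex) \<Rightarrow> ('h \<times> 'b::finite \<Rightarrow> 'h \<times> 'b \<Rightarrow> complex) \<Rightarrow> complex^'b^'b"
  where "steer M \<rho> = (\<chi> k l. \<Sum>\<^sub>\<infinity>i. \<Sum>\<^sub>\<infinity>j. M i j * \<rho> (j, k) (i, l))"

text \<open>
  \<open>\<sigma> a x\<close> stands for \<open>\<sigma>\<^bsub>a|x\<^esub>\<close>. The first argument fixes the type that indexes an orthonormal
  basis of Alice's Hilbert space.
\<close>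

definition assemblage :: "'h itself \<Rightarrow> ('a::finite \<Rightarrow> 'x::finite \<Rightarrow> complex^'b^'b) \<Rightarrow> bool" where
  "assemblage _ \<sigma> \<longleftrightarrow> (\<forall>a x. psd (\<sigma> a x)) \<and>
     (\<exists>(\<rho> :: 'h \<times> 'b \<Rightarrow> 'h \<times> 'b \<Rightarrow> complex) (M :: 'a \<Rightarrow> 'x \<Rightarrow> 'h \<Rightarrow> 'h \<Rightarrow> complex).
        density_op \<rho> \<and> (\<forall>x. povm (\<lambda>a. M a x)) \<and> (\<forall>a x. \<sigma> a x = steer (M a x) \<rho>))"


section \<open>LOSR conversion\<close>

definition complex_linear :: "(complex^'b^'b \<Rightarrow> complex^'c^'c) \<Rightarrow> bool" where
  "complex_linear E \<longleftrightarrow> (\<forall>X Y. E (X + Y) = E X + E Y) \<and>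
     (\<forall>c X. E (mat_scale c X) = mat_scale c (E X))"

text \<open>
  An operator on \<open>\<complex>\<^sup>n \<otimes> H\<close> is a family of blocks \<open>X i j\<close> with \<open>i, j < n\<close>; on it,
  \<open>id \<otimes> E\<close> acts blockwise.
\<close>

definition completely_positive :: "(complex^'b^'b \<Rightarrow> complex^'c^'c) \<Rightarrow> bool" where
  "completely_positive E \<longleftrightarrow> (\<forall>(n::nat) (X :: nat \<Rightarrow> nat \<Rightarrow> complex^'b^'b).
     psd_on ({..<n} \<times> UNIV) (\<lambda>(i, k) (j, l). X i j $ k $ l) \<longrightarrow>
     psd_on ({..<n} \<times> UNIV) (\<lambda>(i, k) (j, l). E (X i j) $ k $ l))"

definition cptp :: "(complex^'b^'b \<Rightarrow> complex^'c^'c) \<Rightarrow> bool" where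
  "cptp E \<longleftrightarrow> complex_linear E \<and> completely_positive E \<and> (\<forall>X. trace (E X) = trace X)"

definition prob_dist :: "'i set \<Rightarrow> ('i \<Rightarrow> real) \<Rightarrow> bool" where
  "prob_dist S p \<longleftrightarrow> (\<forall>i\<in>S. 0 \<le> p i) \<and> sum p S = 1"

text \<open>
  The values of the finite-valued classical variables \<open>\<lambda>\<close> and \<open>c\<close> are labelled by natural numbers
  from finite sets \<open>\<Lambda>\<close> and \<open>C\<close>. The arguments of the conditional distributions come in the order
  condition, then outcome: \<open>q x' \<lambda> (c, x)\<close> is \<open>p(c, x | x', \<lambda>)\<close> and \<open>r a c a'\<close> is
  \<open>p(a' | a, c)\<close>.
\<close>

definition LOSR_convertible ::
  "('a::finite \<Rightarrow> 'x::finite \<Rightarrow> complex^'b^'b) \<Rightarrow> ('ap::finite \<Rightarrow> 'xp::finite \<Rightarrow> complex^'bp^'bp) \<Rightarrow> bool"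
  where
  "LOSR_convertible \<sigma> \<sigma>' \<longleftrightarrow>
     (\<exists>(\<Lambda> :: nat set) (C :: nat set) (p :: nat \<Rightarrow> real) (q :: 'xp \<Rightarrow> nat \<Rightarrow> nat \<times> 'x \<Rightarrow> real)
       (r :: 'a \<Rightarrow> nat \<Rightarrow> 'ap \<Rightarrow> real) (E :: nat \<Rightarrow> complex^'b^'b \<Rightarrow> complex^'bp^'bp).
        finite \<Lambda> \<and> finite C \<and>
        prob_dist \<Lambda> p \<and>
        (\<forall>x'. \<forall>l\<in>\<Lambda>. prob_dist (C \<times> UNIV) (q x' l)) \<and>
        (\<forall>a. \<forall>c\<in>C. prob_dist UNIV (r a c)) \<and>
        (\<forall>l\<in>\<Lambda>. cptp (E l)) \<and>
        (\<forall>a' x'. \<sigma>' a' x' =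
           (\<Sum>l\<in>\<Lambda>. \<Sum>c\<in>C. \<Sum>a\<in>UNIV. \<Sum>x\<in>UNIV.
              (p l * q x' l (c, x) * r a c a') *\<^sub>R E l (\<sigma> a x))))"


section \<open>Deterministic strategies\<close>

type_synonym ('a, 'x, 'ap, 'xp) strategy = "('a \<times> 'xp \<Rightarrow> 'ap) \<times> ('xp \<Rightarrow> 'x)"

text \<open>\<open>D_out a' a x' \<lambda>\<close> is \<open>D(a' | a, x', \<lambda>)\<close> and \<open>D_in x x' \<lambda>\<close> is \<open>D(x | x', \<lambda>)\<close>.\<close>

definition D_out :: "'ap \<Rightarrow> 'a \<Rightarrow> 'xp \<Rightarrow> ('a, 'x, 'ap, 'xp) strategy \<Rightarrow> real" where
  "D_out a' a x' l = (if a' = fst l (a, x') then 1 else 0)"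

definition D_in :: "'x \<Rightarrow> 'xp \<Rightarrow> ('a, 'x, 'ap, 'xp) strategy \<Rightarrow> real" where
  "D_in x x' l = (if x = snd l x' then 1 else 0)"

end

theory Submission
  imports Defs
begin

text \<open>
  Up to normalisation, \<open>W\<^sub>\<lambda>\<close> is the Choi matrix of the map applied by Bob, weighted by the probability
  of the strategy \<open>\<lambda>\<close>: positivity is complete positivity, and the condition on the partial trace is
  trace preservation. The classical part of an LOSR operation is a convex
  mixture of deterministic strategies. Only the marginals for a single input \<open>x'\<close> enter the
  conversion, so given \<open>\<lambda>\<close> the responses to different inputs can be drawn independently.
\<close>

section \<open>Positive semidefinite kernels\<close>

lemma sum_nonneg_Reals:
  "(\<And>i. i \<in> S \<Longrightarrow> f i \<in> \<real>\<^sub>\<ge>\<^sub>0) \<Longrightarrow> (\<Sum>i\<in>S. f i) \<in> \<real>\<^sub>\<ge>\<^sub>0"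
  by (induction S rule: infinite_finite_induct) auto

lemma sum_Times: "(\<Sum>p\<in>A \<times> B. f p) = (\<Sum>a\<in>A. \<Sum>b\<in>B. f (a, b))"
  by (simp add: sum.cartesian_product)

lemma sum_UNIV_prod: "(\<Sum>p\<in>UNIV. f p) = (\<Sum>a\<in>UNIV. \<Sum>b\<in>UNIV. f (a, b))"
  using sum_Times[of f UNIV UNIV] by simp

text \<open>A vector on a subset extends by zero to all of \<open>S\<close> without changing the
  form. So positivity over a finite index set is a statement about one quadratic form.\<close>

lemma psd_on_finite_iff:
  fixes K :: "'a \<Rightarrow> 'a \<Rightarrow> complex"
  assumes "finite S"
  shows "psd_on S K \<longleftrightarrow> (\<forall>v. (\<Sum>i\<in>S. \<Sum>j\<in>S. cnj (v i) * K i j * v j) \<in> \<real>\<^sub>\<ge>\<^sub>0)"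
proof
  assume R: "\<forall>v. (\<Sum>i\<in>S. \<Sum>j\<in>S. cnj (v i) * K i j * v j) \<in> \<real>\<^sub>\<ge>\<^sub>0"
  show "psd_on S K"
    unfolding psd_on_def
  proof (intro allI impI)
    fix F and v :: "'a \<Rightarrow> complex" assume F: "finite F \<and> F \<subseteq> S"
    define w :: "'a \<Rightarrow> complex" where "w i = (if i \<in> F then v i else 0)" for i
    have "(\<Sum>i\<in>F. \<Sum>j\<in>F. cnj (v i) * K i j * v j) = (\<Sum>i\<in>S. \<Sum>j\<in>S. cnj (w i) * K i j * w j)"
      using F assms
      by (intro sum.mono_neutral_cong_left) (auto simp: w_def intro!: sum.mono_neutral_cong_left)
    then show "(\<Sum>i\<in>F. \<Sum>j\<in>F. cnj (v i) * K i j * v j) \<in> \<real>\<^sub>\<ge>\<^sub>0"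
      using R by simp
  qed
qed (use assms in \<open>auto simp: psd_on_def\<close>)

lemma psd_iff:
  "psd A \<longleftrightarrow> (\<forall>v. (\<Sum>i\<in>UNIV. \<Sum>j\<in>UNIV. cnj (v i) * A $ i $ j * v j) \<in> \<real>\<^sub>\<ge>\<^sub>0)"
  unfolding psd_def by (rule psd_on_finite_iff) simp

lemma psd_on_mono: "psd_on S K \<Longrightarrow> T \<subseteq> S \<Longrightarrow> psd_on T K"
  unfolding psd_on_def by blast

lemma psd_on_diag:
  assumes "psd_on S K" "i \<in> S"
  shows "K i i \<in> \<real>\<^sub>\<ge>\<^sub>0"
  using assms(1)[unfolded psd_on_def, rule_format, of "{i}" "\<lambda>_. 1"] assms(2) by simp

lemma psd_on_two_point:
  assumes "psd_on S K" "i \<in> S" "j \<in> S" "i \<noteq> j"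
  shows "cnj \<alpha> * K i i * \<alpha> + cnj \<alpha> * K i j * \<beta> + cnj \<beta> * K j i * \<alpha> + cnj \<beta> * K j j * \<beta> \<in> \<real>\<^sub>\<ge>\<^sub>0"
  using assms(1)[unfolded psd_on_def, rule_format, of "{i, j}" "\<lambda>k. if k = i then \<alpha> else \<beta>"] assms(2-)
  by (simp add: add.assoc split: if_splits)

lemma psd_on_hermitian:
  assumes "psd_on S K" "i \<in> S" "j \<in> S"
  shows "K j i = cnj (K i j)"
proof (cases "i = j")
  case True
  then show ?thesis
    using psd_on_diag[OF assms(1,2)] by (auto simp: complex_nonneg_Reals_iff complex_eq_iff)
next
  case False
  \<comment> \<open>The forms at the test vectors (1, 1) and (1, i) are real, as are the diagonal
    entries. Their vanishing imaginary parts determine the imaginary and the real part of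
    \<open>K j i\<close>.\<close>
  show ?thesis
    using psd_on_two_point[OF assms False, of 1 1] psd_on_two_point[OF assms False, of 1 \<i>]
      psd_on_diag[OF assms(1,2)] psd_on_diag[OF assms(1,3)]
    by (auto simp: complex_nonneg_Reals_iff complex_eq_iff)
qed

text \<open>With a zero diagonal entry at \<open>i\<close>, the two-point form is real-affine in the
  coefficient at \<open>i\<close>, so a nonzero \<open>K i j\<close> could drive it below
  zero.\<close>

lemma psd_on_zero_diag:
  assumes "psd_on S K" "i \<in> S" "j \<in> S" "K i i = 0"
  shows "K i j = 0"
proof (rule ccontr)
  assume nz: "K i j \<noteq> 0"
  then have ij: "i \<noteq> j" using assms(4) by auto
  define n where "n = (cmod (K i j))\<^sup>2"
  have n: "n > 0" using nz by (simp add: n_def)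
  \<comment> \<open>Scaled so that the coefficients \<open>- M * K i j\<close> at \<open>i\<close>
    and 1 at \<open>j\<close> give the form the value -1.\<close>
  define M where "M = (Re (K j j) + 1) / (2 * n)"
  have h: "K j i = cnj (K i j)" by (rule psd_on_hermitian[OF assms(1-3)])
  have e: "cnj (K i j) * K i j = complex_of_real n"
    unfolding n_def using complex_norm_square[of "K i j"] by (simp add: mult.commute)
  have "- complex_of_real M * complex_of_real n - complex_of_real M * complex_of_real n + K j j \<in> \<real>\<^sub>\<ge>\<^sub>0"
    using psd_on_two_point[OF assms(1-3) ij, of "- complex_of_real M * K i j" 1]
    by (simp add: assms(4) h e[symmetric] mult.assoc mult.left_commute algebra_simps)
  then have "0 \<le> Re (K j j) - 2 * M * n"
    by (simp add: complex_nonneg_Reals_iff)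
  also have "\<dots> = - 1" using n by (simp add: M_def field_simps)
  finally show False by simp
qed

text \<open>Schur complement. If \<open>K a a = 0\<close>, then the subtracted term is the junk value 0.\<close>

lemma psd_on_schur_complement:
  assumes "finite S" "psd_on (insert a S) K" "a \<notin> S"
  shows "psd_on S (\<lambda>i j. K i j - K i a * K a j / K a a)"
proof (cases "K a a = 0")
  case True
  then show ?thesis using psd_on_mono[OF assms(2), of S] by auto
next
  case False
  show ?thesis
    unfolding psd_on_finite_iff[OF assms(1)]
  proof
    fix v
    define s where "s = (\<Sum>j\<in>S. K a j * v j)"
    define t where "t = (\<Sum>i\<in>S. cnj (v i) * K i a)"
    \<comment> \<open>The coefficient at \<open>a\<close> completes the square: the first two of the
      four terms below cancel, and \<open>t * w a\<close> supplies the subtracted rank-one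
      form.\<close>
    define w where "w i = (if i = a then - s / K a a else v i)" for i
    define Q where "Q = (\<Sum>i\<in>S. \<Sum>j\<in>S. cnj (v i) * K i j * v j)"
    have ts: "t * s / K a a = (\<Sum>i\<in>S. \<Sum>j\<in>S. cnj (v i) * (K i a * K a j / K a a) * v j)"
      unfolding s_def t_def sum_product sum_divide_distrib by (intro sum.cong refl) simp
    have w: "w i = v i" if "i \<in> S" for i
      using that assms(3) by (auto simp: w_def)
    have "(\<Sum>i\<in>insert a S. \<Sum>j\<in>insert a S. cnj (w i) * K i j * w j)
       = cnj (w a) * K a a * w a + cnj (w a) * s + t * w a + Q"
      using assms(1,3)
      by (simp add: sum.distrib w s_def t_def Q_def sum_distrib_left sum_distrib_right mult.assoc
          cong: sum.cong)
    also have "\<dots> = Q - t * s / K a a"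
      using False by (simp add: w_def)
    also have "\<dots> = (\<Sum>i\<in>S. \<Sum>j\<in>S. cnj (v i) * (K i j - K i a * K a j / K a a) * v j)"
      unfolding ts Q_def sum_subtractf[symmetric]
      by (simp add: right_diff_distrib left_diff_distrib)
    finally have eq: "(\<Sum>i\<in>insert a S. \<Sum>j\<in>insert a S. cnj (w i) * K i j * w j)
       = (\<Sum>i\<in>S. \<Sum>j\<in>S. cnj (v i) * (K i j - K i a * K a j / K a a) * v j)" .
    show "(\<Sum>i\<in>S. \<Sum>j\<in>S. cnj (v i) * (K i j - K i a * K a j / K a a) * v j) \<in> \<real>\<^sub>\<ge>\<^sub>0"
      unfolding eq[symmetric]
      by (rule assms(2)[unfolded psd_on_finite_iff[OF finite.insertI[OF assms(1)]], rule_format])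
  qed
qed

text \<open>Cholesky-type factorisation: split off the rank-one term of row and column
  \<open>a\<close>, then apply the induction hypothesis to the Schur complement.\<close>

lemma psd_on_decompose:
  assumes "finite S" "psd_on S K"
  shows "\<exists>u. \<forall>i\<in>S. \<forall>j\<in>S. K i j = (\<Sum>r\<in>S. u r i * cnj (u r j))"
  using assms
proof (induction S arbitrary: K rule: finite_induct)
  case empty
  then show ?case by simp
next
  case (insert a S)
  obtain u where u: "\<And>i j. i \<in> S \<Longrightarrow> j \<in> S \<Longrightarrow>
      K i j - K i a * K a j / K a a = (\<Sum>r\<in>S. u r i * cnj (u r j))"
    using insert.IH[OF psd_on_schur_complement[OF insert.hyps(1) insert.prems insert.hyps(2)]]
    by blast
  have herm: "cnj (K j a) = K a j" if "j \<in> insert a S" for j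
    using psd_on_hermitian[OF insert.prems, of j a] that by simp
  have zero: "K a j = 0" if "K a a = 0" "j \<in> insert a S" for j
    using psd_on_zero_diag[OF insert.prems _ that(2,1)] by simp
  have zero': "K j a = 0" if "K a a = 0" "j \<in> insert a S" for j
    using zero[OF that] herm[OF that(2)] by (metis complex_cnj_zero_iff)
  \<comment> \<open>If \<open>K a a = 0\<close> then \<open>c = 0\<close>, and division by
    \<open>c\<close> yields 0. That is the right value, since row and column \<open>a\<close> vanish
    by \<open>zero\<close> and \<open>zero'\<close>.\<close>
  define c where "c = complex_of_real (sqrt (Re (K a a)))"
  have cc: "c * cnj c = K a a"
    using psd_on_diag[OF insert.prems, of a]
    by (simp add: c_def complex_nonneg_Reals_iff complex_eq_iff flip: of_real_mult)
  \<comment> \<open>Vector \<open>a\<close> carries the whole row and column \<open>a\<close>; the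
    vectors of the Schur complement are set to 0 at \<open>a\<close>.\<close>
  define w where "w r i = (if r = a then K i a / c else if i = a then 0 else u r i)" for r i
  have split: "(\<Sum>r\<in>insert a S. w r i * cnj (w r j))
      = K i a * K a j / K a a + (\<Sum>r\<in>S. w r i * cnj (w r j))" if "j \<in> insert a S" for i j
    using insert.hyps that by (simp add: w_def herm cc)
  have "K i j = (\<Sum>r\<in>insert a S. w r i * cnj (w r j))" if "i \<in> insert a S" "j \<in> insert a S" for i j
  proof (cases "i = a \<or> j = a")
    case True
    then have "(\<Sum>r\<in>S. w r i * cnj (w r j)) = 0"
      using insert.hyps by (intro sum.neutral) (auto simp: w_def)
    then show ?thesis
      using True zero[of j] zero'[of i] that by (auto simp: split)
  next
    case False
    then have "(\<Sum>r\<in>S. w r i * cnj (w r j)) = (\<Sum>r\<in>S. u r i * cnj (u r j))"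
      using insert.hyps by (intro sum.cong) (auto simp: w_def)
    then show ?thesis
      using False that u[of i j] by (simp only: split) (auto simp: algebra_simps)
  qed
  then show ?case by blast
qed

lemma psd_eq_0:
  assumes "psd A" "\<And>i. A $ i $ i = 0"
  shows "A = 0"
  using psd_on_zero_diag[OF assms(1)[unfolded psd_def]] assms(2) by (simp add: vec_eq_iff)

section \<open>Closure properties of positive semidefinite matrices\<close>

lemma psd_scaleR:
  assumes "psd A" "0 \<le> c"
  shows "psd (c *\<^sub>R A)"
  unfolding psd_iff
proof
  fix v
  have "(\<Sum>i\<in>UNIV. \<Sum>j\<in>UNIV. cnj (v i) * (c *\<^sub>R A) $ i $ j * v j)
     = of_real c * (\<Sum>i\<in>UNIV. \<Sum>j\<in>UNIV. cnj (v i) * A $ i $ j * v j)"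
    by (simp add: sum_distrib_left scaleR_conv_of_real[where 'a = complex] mult.assoc mult.left_commute)
  then show "(\<Sum>i\<in>UNIV. \<Sum>j\<in>UNIV. cnj (v i) * (c *\<^sub>R A) $ i $ j * v j) \<in> \<real>\<^sub>\<ge>\<^sub>0"
    using assms by (simp add: psd_iff nonneg_Reals_mult_I)
qed

lemma psd_add: "psd A \<Longrightarrow> psd B \<Longrightarrow> psd (A + B)"
  by (simp add: psd_iff distrib_left distrib_right sum.distrib nonneg_Reals_add_I)

lemma psd_sum: "(\<And>l. l \<in> S \<Longrightarrow> psd (A l)) \<Longrightarrow> psd (sum A S)"
proof (induction S rule: infinite_finite_induct)
  case (insert l S)
  then show ?case by (simp add: psd_add)
qed (simp_all add: psd_iff)

lemma cnj_mult_self_nonneg: "cnj z * z \<in> \<real>\<^sub>\<ge>\<^sub>0"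
  by (simp add: complex_nonneg_Reals_iff algebra_simps)

lemma psd_mat_1: "psd (mat 1)"
proof -
  have "(\<Sum>j\<in>UNIV. cnj (v i) * (mat 1 :: complex^'a^'a) $ i $ j * v j) = cnj (v i) * v i" for v i
    by (subst sum.remove[of _ i]) (auto simp: mat_def intro!: sum.neutral)
  then show ?thesis
    by (auto simp: psd_iff intro!: sum_nonneg_Reals cnj_mult_self_nonneg)
qed

section \<open>Choi matrices\<close>

text \<open>The linear map with Choi matrix \<open>W\<close>, in the unnormalised convention: the
  factor \<open>real CARD('b)\<close> of the program stays outside.\<close>

definition choi_map :: "complex^('b::finite \<times> 'c::finite)^('b \<times> 'c) \<Rightarrow> complex^'b^'b \<Rightarrow> complex^'c^'c" where
  "choi_map W X = (\<chi> k l. \<Sum>i\<in>UNIV. \<Sum>j\<in>UNIV. W $ (i, k) $ (j, l) * X $ i $ j)"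

text \<open>The left side is the trace expression of the program, so feasibility becomes a statement
  about linear maps. The transpose produces the index order \<open>X $ i $ j\<close>, and the
  identity factor forces the remaining index to be \<open>l\<close>.\<close>

lemma ptrace1_mult_tensor_transpose:
  "ptrace1 (W ** tensor (transpose X) (mat 1)) = choi_map W X"
proof -
  have "(\<Sum>q\<in>UNIV. W $ (i, k) $ q * (X $ i $ fst q * mat 1 $ snd q $ l))
      = (\<Sum>j\<in>UNIV. W $ (i, k) $ (j, l) * X $ i $ j)" for i k l
  proof -
    have "(\<Sum>q\<in>UNIV. W $ (i, k) $ q * (X $ i $ fst q * mat 1 $ snd q $ l))
        = (\<Sum>j\<in>UNIV. \<Sum>m\<in>UNIV. if m = l then W $ (i, k) $ (j, m) * X $ i $ j else 0)"
      unfolding sum_UNIV_prod by (intro sum.cong refl) (auto simp: mat_def)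
    then show ?thesis by simp
  qed
  then show ?thesis
    by (simp add: ptrace1_def matrix_matrix_mult_def tensor_def transpose_def choi_map_def vec_eq_iff)
qed

lemma choi_map_scaleR: "choi_map (c *\<^sub>R W) X = c *\<^sub>R choi_map W X"
  by (simp add: choi_map_def vec_eq_iff scaleR_right.sum)

lemma choi_map_add: "choi_map (V + W) X = choi_map V X + choi_map W X"
  by (simp add: choi_map_def vec_eq_iff distrib_right sum.distrib)

lemma choi_map_0: "choi_map 0 X = 0"
  by (simp add: choi_map_def vec_eq_iff)

lemma choi_map_sum: "choi_map (sum W S) X = (\<Sum>l\<in>S. choi_map (W l) X)"
  by (induction S rule: infinite_finite_induct) (auto simp: choi_map_add choi_map_0)

lemma ptrace2_scaleR: "ptrace2 (c *\<^sub>R W) = c *\<^sub>R ptrace2 W"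
  by (simp add: ptrace2_def vec_eq_iff scaleR_right.sum)

lemma ptrace2_sum: "ptrace2 (sum W S) = (\<Sum>l\<in>S. ptrace2 (W l))"
proof (induction S rule: infinite_finite_induct)
  case (insert l S)
  have "ptrace2 (V + V') = ptrace2 V + ptrace2 V'" for V V' :: "complex^('a \<times> 'b)^('a \<times> 'b)"
    by (simp add: ptrace2_def vec_eq_iff sum.distrib)
  with insert show ?case by simp
qed (auto simp: ptrace2_def vec_eq_iff)

lemma complex_linear_choi_map: "complex_linear (choi_map W)"
  by (simp add: complex_linear_def choi_map_def mat_scale_def map_matrix_def vec_eq_iff distrib_left
      sum.distrib sum_distrib_left mult.left_commute)

text \<open>
  Writing the Choi matrix as a sum of rank-one terms (Kraus decomposition) turns the quadratic form
  of the image into a sum of quadratic forms of the argument.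
\<close>

lemma completely_positive_choi_map:
  fixes W :: "complex^('b::finite \<times> 'c::finite)^('b \<times> 'c)"
  assumes "psd W"
  shows "completely_positive (choi_map W)"
  unfolding completely_positive_def
proof (intro allI impI)
  fix n :: nat and X :: "nat \<Rightarrow> nat \<Rightarrow> complex^'b^'b"
  assume X: "psd_on ({..<n} \<times> UNIV) (\<lambda>(i, k) (j, l). X i j $ k $ l)"
  obtain u :: "'b \<times> 'c \<Rightarrow> 'b \<times> 'c \<Rightarrow> complex"
    where "\<forall>p\<in>UNIV. \<forall>q\<in>UNIV. W $ p $ q = (\<Sum>r\<in>UNIV. u r p * cnj (u r q))"
    using psd_on_decompose[OF finite assms[unfolded psd_def]] by (elim exE) (rule that)
  then have u: "W $ p $ q = (\<Sum>r\<in>UNIV. u r p * cnj (u r q))" for p q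
    by blast
  show "psd_on ({..<n} \<times> UNIV) (\<lambda>(i, k) (j, l). choi_map W (X i j) $ k $ l)"
    unfolding psd_on_finite_iff[OF finite_cartesian_product[OF finite_lessThan finite]]
  proof
    fix v :: "nat \<times> 'c \<Rightarrow> complex"
    \<comment> \<open>The Kraus operator number \<open>r\<close> has the entry
      \<open>u r (i, k)\<close> in row \<open>k\<close> and column \<open>i\<close>;
      \<open>z r\<close> is its adjoint applied to each block of \<open>v\<close>.\<close>
    define z where "z r = (\<lambda>(b, j). \<Sum>l\<in>UNIV. cnj (u r (j, l)) * v (b, l))" for r
    define T where "T r a i b j k l =
      cnj (v (a, k)) * u r (i, k) * X a b $ i $ j * cnj (u r (j, l)) * v (b, l)" for r a i b j k l
    have "(\<Sum>p\<in>{..<n} \<times> UNIV. \<Sum>q\<in>{..<n} \<times> UNIV. cnj (v p) *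
           (case p of (a, k) \<Rightarrow> \<lambda>(b, l). choi_map W (X a b) $ k $ l) q * v q)
       = (\<Sum>a<n. \<Sum>k\<in>UNIV. \<Sum>b<n. \<Sum>l\<in>UNIV. cnj (v (a, k)) * choi_map W (X a b) $ k $ l * v (b, l))"
      by (simp add: sum_Times)
    also have "\<dots> = (\<Sum>a<n. \<Sum>k\<in>UNIV. \<Sum>b<n. \<Sum>l\<in>UNIV. \<Sum>i\<in>UNIV. \<Sum>j\<in>UNIV. \<Sum>r\<in>UNIV. T r a i b j k l)"
      by (simp add: choi_map_def u T_def sum_distrib_left sum_distrib_right mult.assoc mult.left_commute)
    \<comment> \<open>With \<open>r\<close> outermost and \<open>l\<close>, \<open>k\<close>
      innermost, the sums over \<open>l\<close> and \<open>k\<close> assemble into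
      \<open>z r\<close> and its conjugate.\<close>
    also have "\<dots> = (\<Sum>r\<in>UNIV. \<Sum>a<n. \<Sum>i\<in>UNIV. \<Sum>b<n. \<Sum>j\<in>UNIV. \<Sum>l\<in>UNIV. \<Sum>k\<in>UNIV. T r a i b j k l)"
      unfolding sum.cartesian_product
      by (rule sum.reindex_bij_witness[where j = "\<lambda>(a, k, b, l, i, j, r). (r, a, i, b, j, l, k)"
            and i = "\<lambda>(r, a, i, b, j, l, k). (a, k, b, l, i, j, r)"]) auto
    also have "\<dots> = (\<Sum>r\<in>UNIV. \<Sum>p\<in>{..<n} \<times> UNIV. \<Sum>q\<in>{..<n} \<times> UNIV. cnj (z r p) *
           (case p of (a, i) \<Rightarrow> \<lambda>(b, j). X a b $ i $ j) q * z r q)"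
      by (simp add: sum_Times z_def T_def sum_distrib_left sum_distrib_right
          mult.assoc mult.left_commute)
    also have "\<dots> \<in> \<real>\<^sub>\<ge>\<^sub>0"
      by (rule sum_nonneg_Reals)
        (rule X[unfolded psd_on_finite_iff[OF finite_cartesian_product[OF finite_lessThan finite]],
            THEN spec])
    finally show "(\<Sum>p\<in>{..<n} \<times> UNIV. \<Sum>q\<in>{..<n} \<times> UNIV. cnj (v p) *
           (case p of (a, k) \<Rightarrow> \<lambda>(b, l). choi_map W (X a b) $ k $ l) q * v q) \<in> \<real>\<^sub>\<ge>\<^sub>0" .
  qed
qed

text \<open>Summing out the output index leaves only \<open>ptrace2 W\<close>, so trace preservation
  can be read off from this partial trace.\<close>

lemma trace_choi_map: "trace (choi_map W X) = (\<Sum>i\<in>UNIV. \<Sum>j\<in>UNIV. ptrace2 W $ i $ j * X $ i $ j)"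
proof -
  have "trace (choi_map W X) = (\<Sum>i\<in>UNIV. \<Sum>k\<in>UNIV. \<Sum>j\<in>UNIV. W $ (i, k) $ (j, k) * X $ i $ j)"
    unfolding trace_def choi_map_def by (simp, rule sum.swap)
  also have "\<dots> = (\<Sum>i\<in>UNIV. \<Sum>j\<in>UNIV. \<Sum>k\<in>UNIV. W $ (i, k) $ (j, k) * X $ i $ j)"
    by (intro sum.cong refl, rule sum.swap)
  finally show ?thesis
    by (simp add: ptrace2_def sum_distrib_right)
qed

lemma cptp_choi_map:
  assumes "psd W" "ptrace2 W = mat 1"
  shows "cptp (choi_map W)"
proof -
  have "trace (choi_map W X) = trace X" for X
  proof -
    have "trace (choi_map W X) = (\<Sum>i\<in>UNIV. \<Sum>j\<in>UNIV. if i = j then X $ i $ j else 0)"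
      unfolding trace_choi_map assms(2) mat_def by (intro sum.cong) auto
    then show ?thesis by (simp add: trace_def)
  qed
  with assms(1) show ?thesis
    by (simp add: cptp_def complex_linear_choi_map completely_positive_choi_map)
qed

section \<open>The Choi matrix of a given map\<close>

definition matrix_unit :: "'b \<Rightarrow> 'b \<Rightarrow> complex^'b^'b" where
  "matrix_unit i j = (\<chi> k l. if k = i \<and> l = j then 1 else 0)"

text \<open>Unnormalised Choi matrix: its blocks are the images of the matrix units, so a
  trace-preserving map has partial trace \<open>mat 1\<close>, not a multiple with trace 1.\<close>

definition choi :: "(complex^'b^'b \<Rightarrow> complex^'c^'c) \<Rightarrow> complex^('b::finite \<times> 'c::finite)^('b \<times> 'c)" where
  "choi E = (\<chi> p q. E (matrix_unit (fst p) (fst q)) $ snd p $ snd q)"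

lemma complex_linear_sum:
  assumes "complex_linear E"
  shows "E (sum X S) = (\<Sum>i\<in>S. E (X i))"
proof -
  interpret additive E using assms by unfold_locales (simp add: complex_linear_def)
  show ?thesis by (rule sum)
qed

lemma matrix_unit_expansion: "X = (\<Sum>i\<in>UNIV. \<Sum>j\<in>UNIV. mat_scale (X $ i $ j) (matrix_unit i j))"
proof -
  have "(\<Sum>i\<in>UNIV. \<Sum>j\<in>UNIV. mat_scale (X $ i $ j) (matrix_unit i j)) $ k $ l = X $ k $ l" for k l
  proof -
    have "(\<Sum>i\<in>UNIV. \<Sum>j\<in>UNIV. mat_scale (X $ i $ j) (matrix_unit i j)) $ k $ l
       = (\<Sum>i\<in>UNIV. \<Sum>j\<in>UNIV. if l = j then if k = i then X $ i $ j else 0 else 0)"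
      unfolding sum_component by (intro sum.cong) (auto simp: mat_scale_def map_matrix_def matrix_unit_def)
    then show ?thesis by simp
  qed
  then show ?thesis by (simp add: vec_eq_iff)
qed

text \<open>By linearity a map is fixed by its values on matrix units, and these are the blocks of
  its Choi matrix.\<close>

lemma choi_map_choi:
  assumes "complex_linear E"
  shows "choi_map (choi E) X = E X"
proof -
  have "E X = (\<Sum>i\<in>UNIV. \<Sum>j\<in>UNIV. mat_scale (X $ i $ j) (E (matrix_unit i j)))"
    using assms by (subst matrix_unit_expansion) (simp add: complex_linear_sum complex_linear_def)
  then show ?thesis
    by (simp add: vec_eq_iff choi_map_def choi_def mat_scale_def map_matrix_def mult.commute)
qed

text \<open>The block matrix of all matrix units is an unnormalised maximally entangled state.
  Applying \<open>E\<close> blockwise keeps it positive, and the result is the Choi matrix.\<close>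

lemma psd_choi:
  fixes E :: "complex^'b^'b \<Rightarrow> complex^'c^'c"
  assumes "completely_positive E"
  shows "psd (choi E)"
proof -
  \<comment> \<open>The blocks in \<open>completely_positive\<close> are numbered by naturals;
    \<open>e\<close> translates these numbers into basis indices.\<close>
  obtain e where e: "bij_betw e {..<CARD('b)} (UNIV :: 'b set)"
    using ex_bij_betw_nat_finite[of "UNIV :: 'b set"] by (auto simp: lessThan_atLeast0)
  have fin: "finite ({..<CARD('b)} \<times> (UNIV :: 'd::finite set))" by simp
  have "psd_on ({..<CARD('b)} \<times> UNIV) (\<lambda>(i, k) (j, l). matrix_unit (e i) (e j) $ k $ l)"
    unfolding psd_on_finite_iff[OF fin]
  proof
    fix v :: "nat \<times> 'b \<Rightarrow> complex"
    have "(\<Sum>p\<in>{..<CARD('b)} \<times> UNIV. \<Sum>q\<in>{..<CARD('b)} \<times> UNIV. cnj (v p) *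
        (case p of (i, k) \<Rightarrow> \<lambda>(j, l). matrix_unit (e i) (e j) $ k $ l) q * v q)
      = (\<Sum>i<CARD('b). \<Sum>k\<in>UNIV. \<Sum>j<CARD('b). \<Sum>l\<in>UNIV.
           if l = e j then if k = e i then cnj (v (i, k)) * v (j, l) else 0 else 0)"
      unfolding sum_Times by (intro sum.cong refl) (auto simp: matrix_unit_def)
    \<comment> \<open>The inner sums collapse to \<open>l = e j\<close> and \<open>k = e i\<close>,
      so the form is the squared modulus of one linear functional of \<open>v\<close>: the block
      matrix has rank one.\<close>
    also have "\<dots> = (\<Sum>i<CARD('b). \<Sum>k\<in>UNIV. if k = e i then \<Sum>j<CARD('b). cnj (v (i, k)) * v (j, e j) else 0)"
      by (intro sum.cong) auto
    also have "\<dots> = cnj (\<Sum>i<CARD('b). v (i, e i)) * (\<Sum>i<CARD('b). v (i, e i))"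
      by (simp add: sum_product)
    also have "\<dots> \<in> \<real>\<^sub>\<ge>\<^sub>0" by (rule cnj_mult_self_nonneg)
    finally show "(\<Sum>p\<in>{..<CARD('b)} \<times> UNIV. \<Sum>q\<in>{..<CARD('b)} \<times> UNIV. cnj (v p) *
        (case p of (i, k) \<Rightarrow> \<lambda>(j, l). matrix_unit (e i) (e j) $ k $ l) q * v q) \<in> \<real>\<^sub>\<ge>\<^sub>0" .
  qed
  then have psd: "psd_on ({..<CARD('b)} \<times> UNIV) (\<lambda>(i, k) (j, l). E (matrix_unit (e i) (e j)) $ k $ l)"
    by (rule assms[unfolded completely_positive_def, rule_format,
          of "CARD('b)" "\<lambda>i j. matrix_unit (e i) (e j)"])
  show ?thesis
    unfolding psd_iff
  proof
    fix v :: "'b \<times> 'c \<Rightarrow> complex"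
    define w where "w = (\<lambda>(i, k). v (e i, k))"
    have re: "(\<Sum>i\<in>UNIV. f i) = (\<Sum>i<CARD('b). f (e i))" for f :: "'b \<Rightarrow> complex"
      by (rule sum.reindex_bij_betw[OF e, symmetric])
    have "(\<Sum>p\<in>UNIV. \<Sum>q\<in>UNIV. cnj (v p) * choi E $ p $ q * v q)
       = (\<Sum>i\<in>UNIV. \<Sum>k\<in>UNIV. \<Sum>j\<in>UNIV. \<Sum>l\<in>UNIV.
            cnj (v (i, k)) * E (matrix_unit i j) $ k $ l * v (j, l))"
      by (simp add: sum_UNIV_prod choi_def)
    also have "\<dots> = (\<Sum>p\<in>{..<CARD('b)} \<times> UNIV. \<Sum>q\<in>{..<CARD('b)} \<times> UNIV. cnj (w p) *
        (case p of (i, k) \<Rightarrow> \<lambda>(j, l). E (matrix_unit (e i) (e j)) $ k $ l) q * w q)"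
      by (simp add: sum_Times w_def re)
    also have "\<dots> \<in> \<real>\<^sub>\<ge>\<^sub>0"
      using psd unfolding psd_on_finite_iff[OF fin] by blast
    finally show "(\<Sum>p\<in>UNIV. \<Sum>q\<in>UNIV. cnj (v p) * choi E $ p $ q * v q) \<in> \<real>\<^sub>\<ge>\<^sub>0" .
  qed
qed

lemma ptrace2_choi:
  assumes "\<And>X. trace (E X) = trace X"
  shows "ptrace2 (choi E) = mat 1"
proof -
  have "ptrace2 (choi E) $ i $ j = trace (matrix_unit i j)" for i j
    by (simp add: ptrace2_def choi_def assms[symmetric]) (simp add: trace_def)
  also have "trace (matrix_unit i j) = (mat 1 :: complex^'a^'a) $ i $ j" for i j
    by (cases "i = j") (auto simp: trace_def matrix_unit_def mat_def intro!: sum.neutral)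
  finally show ?thesis by (simp add: vec_eq_iff)
qed

section \<open>Distributions over deterministic strategies\<close>

text \<open>Under a product distribution the coordinate \<open>m\<close> has law \<open>Q m\<close>,
  because every other factor sums to 1.\<close>

lemma sum_product_distribution:
  fixes Q :: "'i::finite \<Rightarrow> 'k::finite \<Rightarrow> real"
  assumes "\<And>i. sum (Q i) UNIV = 1"
  shows "(\<Sum>h\<in>UNIV. (\<Prod>i\<in>UNIV. Q i (h i)) * u (h m)) = (\<Sum>k\<in>UNIV. Q m k * u k)"
proof -
  \<comment> \<open>The function \<open>u\<close> is absorbed into the factor at \<open>m\<close>,
    so that the sum over all \<open>h\<close> of a product becomes a product of sums.\<close>
  have "(\<Sum>h\<in>UNIV. (\<Prod>i\<in>UNIV. Q i (h i)) * u (h m))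
      = (\<Sum>h\<in>UNIV. \<Prod>i\<in>UNIV. Q i (h i) * (if i = m then u (h i) else 1))"
    by (simp add: prod.distrib)
  also have "\<dots> = (\<Prod>i\<in>UNIV. \<Sum>k\<in>UNIV. Q i k * (if i = m then u k else 1))"
    using prod_sum_PiE[of UNIV "\<lambda>_. UNIV" "\<lambda>i k. Q i k * (if i = m then u k else 1)"]
    by simp
  also have "\<dots> = (\<Prod>i\<in>UNIV. if i = m then \<Sum>k\<in>UNIV. Q m k * u k else 1)"
    using assms by (intro prod.cong) auto
  finally show ?thesis by simp
qed

text \<open>For each input \<open>x'\<close>, draw \<open>c\<close> and \<open>x\<close> from
  \<open>q x'\<close>, then draw an output for every \<open>a\<close> independently from
  \<open>r a c\<close>; different inputs are treated independently. At a single \<open>x'\<close>,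
  the common \<open>c\<close> preserves the correlation between \<open>x\<close> and the
  outputs.\<close>

lemma strategy_distribution:
  fixes q :: "'xp::finite \<Rightarrow> nat \<times> 'x::finite \<Rightarrow> real" and r :: "'a::finite \<Rightarrow> nat \<Rightarrow> 'ap::finite \<Rightarrow> real"
  assumes "\<And>x'. prob_dist (C \<times> UNIV) (q x')" and "\<And>a c. c \<in> C \<Longrightarrow> prob_dist UNIV (r a c)"
  obtains P :: "('a, 'x, 'ap, 'xp) strategy \<Rightarrow> real" where
    "prob_dist UNIV P"
    "\<And>a a' x x'. (\<Sum>s\<in>UNIV. P s * (D_out a' a x' s * D_in x x' s)) = (\<Sum>c\<in>C. q x' (c, x) * r a c a')"
proof -
  \<comment> \<open>The law at input \<open>x'\<close> of the pair of a chosen \<open>x\<close> and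
    an output rule \<open>'a \<Rightarrow> 'ap\<close>, with the message \<open>c\<close> summed
    out.\<close>
  define Q where "Q x' k = (\<Sum>c\<in>C. q x' (c, fst k) * (\<Prod>a\<in>UNIV. r a c (snd k a)))"
    for x' and k :: "'x \<times> ('a \<Rightarrow> 'ap)"
  define P :: "('a, 'x, 'ap, 'xp) strategy \<Rightarrow> real"
    where "P s = (\<Prod>x'\<in>UNIV. Q x' (snd s x', \<lambda>a. fst s (a, x')))" for s
  have r1: "sum (r a c) UNIV = 1" if "c \<in> C" for a c
    using assms(2)[OF that] by (simp add: prob_dist_def)
  \<comment> \<open>One identity for product test functions serves twice: constants give the
    normalisation of \<open>Q\<close>, indicators give the required marginals.\<close>
  have Qu: "(\<Sum>k\<in>UNIV. Q x' k * (u (snd k a) * w (fst k)))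
      = (\<Sum>c\<in>C. \<Sum>x\<in>UNIV. q x' (c, x) * w x * (\<Sum>a'\<in>UNIV. r a c a' * u a'))"
    for x' a and u :: "'ap \<Rightarrow> real" and w :: "'x \<Rightarrow> real"
  proof -
    have "(\<Sum>k\<in>UNIV. Q x' k * (u (snd k a) * w (fst k)))
       = (\<Sum>x\<in>UNIV. \<Sum>\<phi>\<in>UNIV. \<Sum>c\<in>C. q x' (c, x) * w x * ((\<Prod>a\<in>UNIV. r a c (\<phi> a)) * u (\<phi> a)))"
      by (simp add: sum_UNIV_prod Q_def sum_distrib_left sum_distrib_right mult_ac)
    also have "\<dots> = (\<Sum>x\<in>UNIV. \<Sum>c\<in>C. \<Sum>\<phi>\<in>UNIV. q x' (c, x) * w x * ((\<Prod>a\<in>UNIV. r a c (\<phi> a)) * u (\<phi> a)))"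
      by (intro sum.cong refl, rule sum.swap)
    also have "\<dots> = (\<Sum>c\<in>C. \<Sum>x\<in>UNIV. \<Sum>\<phi>\<in>UNIV. q x' (c, x) * w x * ((\<Prod>a\<in>UNIV. r a c (\<phi> a)) * u (\<phi> a)))"
      by (rule sum.swap)
    also have "\<dots> = (\<Sum>c\<in>C. \<Sum>x\<in>UNIV. q x' (c, x) * w x * (\<Sum>a'\<in>UNIV. r a c a' * u a'))"
      using sum_product_distribution[of "\<lambda>a. r a c" u a for c, OF r1]
      by (intro sum.cong refl) (simp add: sum_distrib_left[symmetric])
    finally show ?thesis .
  qed
  \<comment> \<open>With constant test functions the choice of \<open>a\<close> is immaterial, hence
    \<open>undefined\<close>.\<close>
  have Q1: "sum (Q x') UNIV = 1" for x'
    using Qu[of x' "\<lambda>_. 1" undefined "\<lambda>_. 1"] assms(1)[of x'] r1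
    by (simp add: prob_dist_def sum.cartesian_product)
  have PQ: "(\<Sum>s\<in>UNIV. P s * u (snd s x') (\<lambda>a. fst s (a, x'))) = (\<Sum>k\<in>UNIV. Q x' k * u (fst k) (snd k))"
    for x' u
  proof -
    \<comment> \<open>By currying, a strategy is the same as a function \<open>h\<close> from inputs
      to pairs of an \<open>x\<close> and an output rule.\<close>
    have "(\<Sum>s\<in>UNIV. P s * u (snd s x') (\<lambda>a. fst s (a, x')))
        = (\<Sum>h\<in>UNIV. (\<Prod>y\<in>UNIV. Q y (h y)) * u (fst (h x')) (snd (h x')))"
      by (rule sum.reindex_bij_witness[where j = "\<lambda>s x'. (snd s x', \<lambda>a. fst s (a, x'))"
            and i = "\<lambda>h. (\<lambda>(a, x'). snd (h x') a, \<lambda>x'. fst (h x'))"]) (auto simp: P_def)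
    also have "\<dots> = (\<Sum>k\<in>UNIV. Q x' k * u (fst k) (snd k))"
      by (rule sum_product_distribution[OF Q1, where u = "\<lambda>k. u (fst k) (snd k)"])
    finally show ?thesis .
  qed
  show ?thesis
  proof
    have "0 \<le> Q x' k" for x' k
      using assms unfolding Q_def prob_dist_def
      by (intro sum_nonneg mult_nonneg_nonneg prod_nonneg) auto
    then show "prob_dist UNIV P"
      using PQ[of "\<lambda>_ _. 1"] Q1 by (auto simp: prob_dist_def P_def intro!: prod_nonneg)
    fix a a' x x'
    have "(\<Sum>s\<in>UNIV. P s * (D_out a' a x' s * D_in x x' s))
        = (\<Sum>k\<in>UNIV. Q x' k * (of_bool (a' = snd k a) * of_bool (x = fst k)))"
      using PQ[of "\<lambda>y \<phi>. of_bool (a' = \<phi> a) * of_bool (x = y)" x']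
      by (simp add: D_out_def D_in_def of_bool_def)
    also have "\<dots> = (\<Sum>c\<in>C. q x' (c, x) * r a c a')"
      unfolding Qu[of x' "\<lambda>b. of_bool (a' = b)" a "\<lambda>y. of_bool (x = y)"]
      by (simp add: of_bool_def if_distrib[of "\<lambda>z. _ * z"] if_distrib[of "\<lambda>z. z * _"] cong: if_cong)
    finally show "(\<Sum>s\<in>UNIV. P s * (D_out a' a x' s * D_in x x' s)) = (\<Sum>c\<in>C. q x' (c, x) * r a c a')" .
  qed
qed

section \<open>Passing between LOSR protocols and feasible points of the program\<close>

text \<open>Allows the shared variable and the message to range over arbitrary finite types:
  injections into the naturals supply the labels that \<open>LOSR_convertible\<close> asks
  for.\<close>

lemma LOSR_convertibleI:
  fixes p :: "'l::finite \<Rightarrow> real" and q :: "'xp::finite \<Rightarrow> 'l \<Rightarrow> 'c::finite \<times> 'x::finite \<Rightarrow> real"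
  assumes "prob_dist UNIV p" "\<And>x' l. prob_dist UNIV (q x' l)" "\<And>a c. prob_dist UNIV (r a c)"
    and "\<And>l. cptp (E l)"
    and "\<And>a' x'. \<sigma>' a' x' = (\<Sum>l\<in>UNIV. \<Sum>c\<in>UNIV. \<Sum>a\<in>UNIV. \<Sum>x\<in>UNIV.
              (p l * q x' l (c, x) * r a c a') *\<^sub>R E l (\<sigma> a x))"
  shows "LOSR_convertible \<sigma> \<sigma>'"
proof -
  obtain e :: "'l \<Rightarrow> nat" where e: "inj e"
    using finite_imp_inj_to_nat_seg[of "UNIV :: 'l set"] by auto
  obtain g :: "'c \<Rightarrow> nat" where g: "inj g"
    using finite_imp_inj_to_nat_seg[of "UNIV :: 'c set"] by auto
  have "prob_dist (range e) (\<lambda>l. p (inv e l))"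
    using assms(1) e by (simp add: prob_dist_def sum.reindex)
  moreover have "prob_dist (range g \<times> UNIV) (\<lambda>(c, x). q x' l (inv g c, x))" for x' l
    using assms(2)[of x' l] g
    by (auto simp: prob_dist_def sum.cartesian_product[symmetric] sum.reindex)
      (simp add: sum.cartesian_product)
  ultimately show ?thesis
    unfolding LOSR_convertible_def using assms(3-5) e g
    by (intro exI[of _ "range e"] exI[of _ "range g"] exI[of _ "\<lambda>l. p (inv e l)"]
        exI[of _ "\<lambda>x' l (c, x). q x' (inv e l) (inv g c, x)"] exI[of _ "\<lambda>a c. r a (inv g c)"]
        exI[of _ "\<lambda>l. E (inv e l)"]) (simp add: sum.reindex)
qed

text \<open>Each value \<open>l\<close> of the shared variable induces a distribution
  \<open>P l\<close> over strategies. Regrouping by strategy mixes the maps \<open>E l\<close> with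
  weights \<open>p l * P l s\<close>, and \<open>t s\<close> is the total probability of
  \<open>s\<close>.\<close>

lemma LOSR_convertible_imp_feasible:
  fixes \<sigma> :: "'a::finite \<Rightarrow> 'x::finite \<Rightarrow> complex^'b^'b"
    and \<sigma>' :: "'ap::finite \<Rightarrow> 'xp::finite \<Rightarrow> complex^'bp^'bp"
  assumes "LOSR_convertible \<sigma> \<sigma>'"
  obtains W :: "('a, 'x, 'ap, 'xp) strategy \<Rightarrow> complex^('b \<times> 'bp)^('b \<times> 'bp)"
    and t :: "('a, 'x, 'ap, 'xp) strategy \<Rightarrow> real"
  where "\<And>s. psd (W s)" "\<And>s. ptrace2 (W s) = (t s / real CARD('b)) *\<^sub>R mat 1" "sum t UNIV = 1"
    "\<And>a' x'. \<sigma>' a' x' = (\<Sum>s\<in>UNIV. \<Sum>a\<in>UNIV. \<Sum>x\<in>UNIV.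
       (D_out a' a x' s * D_in x x' s * real CARD('b)) *\<^sub>R choi_map (W s) (\<sigma> a x))"
proof -
  obtain \<Lambda> and C :: "nat set" and p q r and E :: "nat \<Rightarrow> complex^'b^'b \<Rightarrow> complex^'bp^'bp" where
    p: "prob_dist \<Lambda> p" and q: "\<forall>x'. \<forall>l\<in>\<Lambda>. prob_dist (C \<times> UNIV) (q x' l)"
    and r: "\<forall>a. \<forall>c\<in>C. prob_dist UNIV (r a c)" and E: "\<forall>l\<in>\<Lambda>. cptp (E l)"
    and \<sigma>': "\<forall>a' x'. \<sigma>' a' x' = (\<Sum>l\<in>\<Lambda>. \<Sum>c\<in>C. \<Sum>a\<in>UNIV. \<Sum>x\<in>UNIV.
              (p l * q x' l (c, x) * r a c a') *\<^sub>R E l (\<sigma> a x))"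
    using assms unfolding LOSR_convertible_def by (elim exE conjE) (rule that)
  have "\<exists>P :: ('a, 'x, 'ap, 'xp) strategy \<Rightarrow> real. prob_dist UNIV P \<and> (\<forall>a a' x x'.
      (\<Sum>s\<in>UNIV. P s * (D_out a' a x' s * D_in x x' s)) = (\<Sum>c\<in>C. q x' l (c, x) * r a c a'))"
    if "l \<in> \<Lambda>" for l
    by (rule strategy_distribution[of C "\<lambda>x'. q x' l" r]) (use q r that in blast)+
  then obtain P :: "nat \<Rightarrow> ('a, 'x, 'ap, 'xp) strategy \<Rightarrow> real" where
    P_marg: "\<forall>l\<in>\<Lambda>. prob_dist UNIV (P l) \<and> (\<forall>a a' x x'.
      (\<Sum>s\<in>UNIV. P l s * (D_out a' a x' s * D_in x x' s)) = (\<Sum>c\<in>C. q x' l (c, x) * r a c a'))"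
    by (elim bchoice[OF ballI, elim_format] exE)
  have P: "prob_dist UNIV (P l)" and
    marg: "(\<Sum>s\<in>UNIV. P l s * (D_out a' a x' s * D_in x x' s)) = (\<Sum>c\<in>C. q x' l (c, x) * r a c a')"
    if "l \<in> \<Lambda>" for l a a' x x'
    using P_marg that by blast+
  define d where "d = real CARD('b)"
  have d: "d > 0" by (simp add: d_def)
  \<comment> \<open>Dividing by \<open>d\<close> turns the partial trace \<open>mat 1\<close> of
    each Choi matrix into the normalised identity; the factor \<open>real CARD('b)\<close> in the
    program undoes it.\<close>
  define W where "W s = (\<Sum>l\<in>\<Lambda>. (p l * P l s / d) *\<^sub>R choi (E l))" for s
  define t where "t s = (\<Sum>l\<in>\<Lambda>. p l * P l s)" for s
  have pP: "0 \<le> p l * P l s" if "l \<in> \<Lambda>" for l s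
    using p P[OF that] that by (simp add: prob_dist_def del: split_paired_All)
  show thesis
  proof
    fix s
    show "psd (W s)"
      unfolding W_def using pP E d by (intro psd_sum psd_scaleR psd_choi) (auto simp: cptp_def)
    have "ptrace2 (W s) = (\<Sum>l\<in>\<Lambda>. (p l * P l s / d) *\<^sub>R mat 1)"
      unfolding W_def ptrace2_sum ptrace2_scaleR
      using E by (intro sum.cong refl) (simp add: ptrace2_choi cptp_def)
    then show "ptrace2 (W s) = (t s / real CARD('b)) *\<^sub>R mat 1"
      by (simp add: t_def d_def sum_divide_distrib scaleR_left.sum)
  next
    have "sum t UNIV = (\<Sum>l\<in>\<Lambda>. p l * sum (P l) UNIV)"
      unfolding t_def by (subst sum.swap) (simp add: sum_distrib_left)
    then show "sum t UNIV = 1"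
      using p P by (simp add: prob_dist_def)
  next
    fix a' x'
    have "(\<Sum>s\<in>UNIV. \<Sum>a\<in>UNIV. \<Sum>x\<in>UNIV.
            (D_out a' a x' s * D_in x x' s * real CARD('b)) *\<^sub>R choi_map (W s) (\<sigma> a x))
      = (\<Sum>s\<in>UNIV. \<Sum>a\<in>UNIV. \<Sum>x\<in>UNIV. \<Sum>l\<in>\<Lambda>.
            (p l * (P l s * (D_out a' a x' s * D_in x x' s))) *\<^sub>R E l (\<sigma> a x))"
      unfolding W_def choi_map_sum choi_map_scaleR d_def[symmetric] scaleR_right.sum scaleR_scaleR
      using E d by (intro sum.cong refl) (simp add: choi_map_choi cptp_def mult_ac)
    \<comment> \<open>With the sum over strategies innermost, \<open>marg\<close> turns the
      deterministic responses back into \<open>q\<close> and \<open>r\<close>.\<close>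
    also have "\<dots> = (\<Sum>l\<in>\<Lambda>. \<Sum>a\<in>UNIV. \<Sum>x\<in>UNIV. \<Sum>s\<in>UNIV.
            (p l * (P l s * (D_out a' a x' s * D_in x x' s))) *\<^sub>R E l (\<sigma> a x))"
      unfolding sum.cartesian_product
      by (rule sum.reindex_bij_witness[where j = "\<lambda>(s, a, x, l). (l, a, x, s)"
            and i = "\<lambda>(l, a, x, s). (s, a, x, l)"]) auto
    also have "\<dots> = (\<Sum>l\<in>\<Lambda>. \<Sum>a\<in>UNIV. \<Sum>x\<in>UNIV. (p l * (\<Sum>c\<in>C. q x' l (c, x) * r a c a')) *\<^sub>R E l (\<sigma> a x))"
      by (intro sum.cong refl)
        (simp add: marg[symmetric] sum_distrib_left scaleR_left.sum)
    also have "\<dots> = (\<Sum>l\<in>\<Lambda>. \<Sum>a\<in>UNIV. \<Sum>x\<in>UNIV. \<Sum>c\<in>C. (p l * q x' l (c, x) * r a c a') *\<^sub>R E l (\<sigma> a x))"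
      by (simp add: sum_distrib_left scaleR_left.sum mult.assoc)
    also have "\<dots> = \<sigma>' a' x'"
      unfolding \<sigma>'[rule_format] sum.cartesian_product
      by (rule sum.reindex_bij_witness[where j = "\<lambda>(l, a, x, c). (l, c, a, x)"
            and i = "\<lambda>(l, c, a, x). (l, a, x, c)"]) auto
    finally show "\<sigma>' a' x' = (\<Sum>s\<in>UNIV. \<Sum>a\<in>UNIV. \<Sum>x\<in>UNIV.
       (D_out a' a x' s * D_in x x' s * real CARD('b)) *\<^sub>R choi_map (W s) (\<sigma> a x))" ..
  qed
qed

text \<open>The strategy itself becomes the shared variable. Its probability \<open>p s\<close> is
  the proportionality factor of the partial trace, and rescaling \<open>W s\<close> by
  \<open>d / p s\<close> gives the Choi matrix of Bob's map.\<close>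

lemma feasible_imp_LOSR_convertible:
  fixes \<sigma> :: "'a::finite \<Rightarrow> 'x::finite \<Rightarrow> complex^'b^'b"
    and \<sigma>' :: "'ap::finite \<Rightarrow> 'xp::finite \<Rightarrow> complex^'bp^'bp"
    and W :: "('a, 'x, 'ap, 'xp) strategy \<Rightarrow> complex^('b \<times> 'bp)^('b \<times> 'bp)"
  assumes W: "\<And>s. psd (W s)"
    and ptrace2_W: "\<And>s. \<exists>c. ptrace2 (W s) = mat_scale c ((1 / real CARD('b)) *\<^sub>R mat 1)"
    and sum_W: "(\<Sum>s\<in>UNIV. ptrace2 (W s)) = (1 / real CARD('b)) *\<^sub>R mat 1"
    and \<sigma>': "\<And>a' x'. \<sigma>' a' x' = (\<Sum>s\<in>UNIV. \<Sum>a\<in>UNIV. \<Sum>x\<in>UNIV.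
       (D_out a' a x' s * D_in x x' s * real CARD('b)) *\<^sub>R choi_map (W s) (\<sigma> a x))"
  shows "LOSR_convertible \<sigma> \<sigma>'"
proof -
  obtain t where t: "\<And>s. ptrace2 (W s) = mat_scale (t s) ((1 / real CARD('b)) *\<^sub>R mat 1)"
    using ptrace2_W by metis
  define d where "d = real CARD('b)"
  have d: "d > 0" by (simp add: d_def)
  have diag: "W s $ p $ p \<in> \<real>\<^sub>\<ge>\<^sub>0" for s p
    using psd_on_diag[OF W[unfolded psd_def]] by simp
  have tr: "(\<Sum>k\<in>UNIV. W s $ (i, k) $ (i, k)) = t s / of_real d" for s i
    using arg_cong[OF t, of "\<lambda>A. A $ i $ i" s]
    by (simp add: ptrace2_def mat_scale_def map_matrix_def mat_def d_def scaleR_conv_of_real[where 'a = complex]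
        field_simps)
  \<comment> \<open>A diagonal entry of the partial trace is a sum of nonnegative reals, which makes
    the a priori complex factor \<open>t s\<close> real and nonnegative. Here
    \<open>undefined\<close> is an arbitrary basis index.\<close>
  have "t s / of_real d \<in> \<real>\<^sub>\<ge>\<^sub>0" for s
    using tr[of s undefined] diag by (metis (no_types, lifting) sum_nonneg_Reals)
  then have "of_real d * (t s / of_real d) \<in> \<real>\<^sub>\<ge>\<^sub>0" for s
    using d by (intro nonneg_Reals_mult_I) auto
  then have t_nonneg: "t s \<in> \<real>\<^sub>\<ge>\<^sub>0" for s
    using d by simp
  define p where "p s = Re (t s)" for s
  have p: "0 \<le> p s" and tp: "t s = of_real (p s)" for s
    using t_nonneg[of s] by (auto simp: p_def complex_nonneg_Reals_iff complex_eq_iff)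
  have "(\<Sum>s\<in>UNIV. t s / of_real d) = 1 / of_real d"
    using arg_cong[OF sum_W, of "\<lambda>A. A $ undefined $ undefined"]
    by (simp add: ptrace2_def tr mat_def d_def scaleR_conv_of_real[where 'a = complex])
  then have "(\<Sum>s\<in>UNIV. t s) = 1"
    using d by (simp add: sum_divide_distrib[symmetric])
  then have p1: "sum p UNIV = 1"
    by (simp add: p_def flip: Re_sum)
  \<comment> \<open>A strategy of probability zero has vanishing partial trace, so all its
    nonnegative diagonal entries vanish, and with them the matrix.\<close>
  have W0: "W s = 0" if "p s = 0" for s
  proof (rule psd_eq_0[OF W])
    fix ik :: "'b \<times> 'bp"
    obtain i k where ik: "ik = (i, k)" by fastforce
    have "(\<Sum>k\<in>UNIV. Re (W s $ (i, k) $ (i, k))) = 0"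
      using arg_cong[OF tr, of Re s i] that by (simp add: tp)
    then have "Re (W s $ (i, k) $ (i, k)) = 0"
      using diag by (subst (asm) sum_nonneg_eq_0_iff) (auto simp: complex_nonneg_Reals_iff)
    then show "W s $ ik $ ik = 0"
      using diag[of s "(i, k)"] by (simp add: ik complex_nonneg_Reals_iff complex_eq_iff)
  qed
  \<comment> \<open>At probability zero any channel will do; the choice is the completely
    depolarising one, which sends \<open>X\<close> to \<open>trace X\<close> times the maximally
    mixed state.\<close>
  define V where "V s = (if p s = 0 then (1 / real CARD('bp)) *\<^sub>R mat 1 else (d / p s) *\<^sub>R W s)" for s
  have "cptp (choi_map (V s))" for s
  proof (rule cptp_choi_map)
    show "psd (V s)"
      using p[of s] d W[of s] by (auto simp: V_def intro!: psd_scaleR psd_mat_1)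
    show "ptrace2 (V s) = mat 1"
    proof (cases "p s = 0")
      case True
      have "ptrace2 (mat 1 :: complex^('b \<times> 'bp)^('b \<times> 'bp)) = real CARD('bp) *\<^sub>R mat 1"
        by (simp add: ptrace2_def mat_def vec_eq_iff scaleR_conv_of_real[where 'a = complex])
      with True show ?thesis by (simp add: V_def ptrace2_scaleR)
    next
      case False
      then show ?thesis
        using d by (simp add: V_def ptrace2_scaleR t tp d_def[symmetric] vec_eq_iff mat_scale_def
            map_matrix_def mat_def scaleR_conv_of_real[where 'a = complex])
    qed
  qed
  moreover have pV: "p s *\<^sub>R choi_map (V s) X = d *\<^sub>R choi_map (W s) X" for s X
    using W0[of s] by (simp add: V_def choi_map_scaleR choi_map_0)
  \<comment> \<open>The message \<open>c\<close> carries the strategy and the input \<open>x'\<close>.\<close>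
  define q :: "'xp \<Rightarrow> ('a, 'x, 'ap, 'xp) strategy \<Rightarrow> (('a, 'x, 'ap, 'xp) strategy \<times> 'xp) \<times> 'x \<Rightarrow> real"
    where "q x' s k = (if k = ((s, x'), snd s x') then 1 else 0)" for x' s k
  define r :: "'a \<Rightarrow> ('a, 'x, 'ap, 'xp) strategy \<times> 'xp \<Rightarrow> 'ap \<Rightarrow> real"
    where "r a c a' = D_out a' a (snd c) (fst c)" for a c a'
  have "\<sigma>' a' x' = (\<Sum>s\<in>UNIV. \<Sum>c\<in>UNIV. \<Sum>a\<in>UNIV. \<Sum>x\<in>UNIV.
          (p s * q x' s (c, x) * r a c a') *\<^sub>R choi_map (V s) (\<sigma> a x))" for a' x'
  proof -
    have "(\<Sum>c\<in>UNIV. \<Sum>a\<in>UNIV. \<Sum>x\<in>UNIV. (p s * q x' s (c, x) * r a c a') *\<^sub>R choi_map (V s) (\<sigma> a x))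
      = (\<Sum>a\<in>UNIV. \<Sum>x\<in>UNIV. (D_out a' a x' s * D_in x x' s * d) *\<^sub>R choi_map (W s) (\<sigma> a x))" for s
    proof -
      \<comment> \<open>Since \<open>q\<close> is a point mass, only the message
        \<open>(s, x')\<close> contributes.\<close>
      have "(\<Sum>c\<in>UNIV. \<Sum>a\<in>UNIV. \<Sum>x\<in>UNIV. (p s * q x' s (c, x) * r a c a') *\<^sub>R choi_map (V s) (\<sigma> a x))
        = (\<Sum>c\<in>UNIV. if c = (s, x') then \<Sum>a\<in>UNIV. \<Sum>x\<in>UNIV.
             (D_out a' a x' s * D_in x x' s) *\<^sub>R (p s *\<^sub>R choi_map (V s) (\<sigma> a x)) else 0)"
        by (intro sum.cong refl) (auto simp: q_def r_def D_in_def mult_ac intro!: sum.cong)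
      then show ?thesis by (simp add: pV)
    qed
    then show ?thesis by (simp add: \<sigma>' d_def)
  qed
  ultimately show ?thesis
    using p p1 by (intro LOSR_convertibleI[of p q r "\<lambda>s. choi_map (V s)"])
      (auto simp: prob_dist_def q_def r_def D_out_def)
qed

theorem mainTheorem1:
  fixes \<sigma> :: "'a::finite \<Rightarrow> 'x::finite \<Rightarrow> complex^'b^'b"
    and \<sigma>' :: "'ap::finite \<Rightarrow> 'xp::finite \<Rightarrow> complex^'bp^'bp"
  assumes "assemblage TYPE('h) \<sigma>" and "assemblage TYPE('hp) \<sigma>'"
  shows "LOSR_convertible \<sigma> \<sigma>' \<longleftrightarrow>
    (\<exists>W :: ('a, 'x, 'ap, 'xp) strategy \<Rightarrow> complex^('b \<times> 'bp)^('b \<times> 'bp).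
       (\<forall>l. psd (W l) \<and>
            (\<exists>s::complex. ptrace2 (W l) = mat_scale s ((1 / real CARD('b)) *\<^sub>R mat 1))) \<and>
       (\<Sum>l\<in>UNIV. ptrace2 (W l)) = (1 / real CARD('b)) *\<^sub>R mat 1 \<and>
       (\<forall>a' x'. \<sigma>' a' x' =
          (\<Sum>l\<in>UNIV. \<Sum>a\<in>UNIV. \<Sum>x\<in>UNIV.
             (D_out a' a x' l * D_in x x' l * real CARD('b)) *\<^sub>R
               ptrace1 (W l ** tensor (transpose (\<sigma> a x)) (mat 1)))))"
  (is "_ \<longleftrightarrow> ?feasible")
proof
  assume "LOSR_convertible \<sigma> \<sigma>'"
  then obtain W :: "('a, 'x, 'ap, 'xp) strategy \<Rightarrow> complex^('b \<times> 'bp)^('b \<times> 'bp)" and t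
    where W: "\<And>s. psd (W s)" and t: "\<And>s. ptrace2 (W s) = (t s / real CARD('b)) *\<^sub>R mat 1"
      and t1: "sum t UNIV = 1"
      and \<sigma>': "\<And>a' x'. \<sigma>' a' x' = (\<Sum>s\<in>UNIV. \<Sum>a\<in>UNIV. \<Sum>x\<in>UNIV.
       (D_out a' a x' s * D_in x x' s * real CARD('b)) *\<^sub>R choi_map (W s) (\<sigma> a x))"
    by (rule LOSR_convertible_imp_feasible) (rule that)
  \<comment> \<open>The program allows a complex proportionality factor; here it is the real weight
    \<open>t s\<close>.\<close>
  have "ptrace2 (W s) = mat_scale (of_real (t s)) ((1 / real CARD('b)) *\<^sub>R mat 1)" for s
    unfolding t by (simp add: mat_scale_def map_matrix_def vec_eq_iff scaleR_conv_of_real[where 'a = complex])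
  then have ex: "\<exists>c. ptrace2 (W s) = mat_scale c ((1 / real CARD('b)) *\<^sub>R mat 1)" for s
    by blast
  have sum_W: "(\<Sum>s\<in>UNIV. ptrace2 (W s)) = (1 / real CARD('b)) *\<^sub>R mat 1"
    unfolding t by (simp add: t1 flip: scaleR_left.sum sum_divide_distrib)
  show ?feasible
    unfolding ptrace1_mult_tensor_transpose
    by (intro exI[of _ W] conjI allI W ex sum_W \<sigma>')
next
  assume ?feasible
  then obtain W :: "('a, 'x, 'ap, 'xp) strategy \<Rightarrow> complex^('b \<times> 'bp)^('b \<times> 'bp)" where
    W: "\<forall>l. psd (W l) \<and>
          (\<exists>s::complex. ptrace2 (W l) = mat_scale s ((1 / real CARD('b)) *\<^sub>R mat 1))"
      "(\<Sum>l\<in>UNIV. ptrace2 (W l)) = (1 / real CARD('b)) *\<^sub>R mat 1"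
      "\<forall>a' x'. \<sigma>' a' x' = (\<Sum>l\<in>UNIV. \<Sum>a\<in>UNIV. \<Sum>x\<in>UNIV.
         (D_out a' a x' l * D_in x x' l * real CARD('b)) *\<^sub>R choi_map (W l) (\<sigma> a x))"
    unfolding ptrace1_mult_tensor_transpose by (elim exE conjE) (rule that)
  show "LOSR_convertible \<sigma> \<sigma>'"
    by (rule feasible_imp_LOSR_convertible[of W, OF _ _ W(2) W(3)[rule_format]]) (use W(1) in blast)+
qed

end
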